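(* Consider the problem FirstStage described in the context. Let $\widehat{p}_{j/i},\widehat{p}_{M/ij},\widehat{p}_{m/M}^{\,ij},\widehat{p}_{r/ijm}$ (all positive) be an optimal primal solution, and let $\frac1{\widehat\theta_j},\frac1{\widehat\theta_m},\frac{\widehat\tau_M}{\widehat\theta_m},\widehat\beta_k,\widehat\beta_q$ (with $\widehat\theta_j,\widehat\theta_m,\widehat\tau_M>0$) be the corresponding optimal dual solution, i.e. the Lagrange multipliers of the constraints (R1), (R2), (R3), (A1), (A2), respectively. Then they satisfy the hierarchical extended logit model: setting $$V_{ij}=\sum_k\widehat\beta_kX^k_{ij},\qquad V_{ijm}=\sum_q\widehat\beta_qX^q_{ijm},\qquad V_{ijmr}=-g_{ijmr},$$ where $g_{ijmr}$ is the generalized route cost evaluated at the link flows of the optimal solution, and $$S_{ijm}=\frac1{\theta_r}\ln\sum_{r\in R_{ijm}}PS^{ijm}_r e^{\theta_rV_{ijmr}},\qquad IV_M^{ij}=\widehat\tau_M\ln\sum_{m\in M}e^{\widehat\theta_m(V_{ijm}+S_{ijm})/\widehat\tau_M},\qquad S_{ij}=\frac1{\widehat\theta_m}\ln\sum_{M\in\mathcal{N}}e^{IV_M^{ij}},$$ one has for all $i\in I$, $j\in J$, $M\in\mathcal{N}$, $m\in M$, $r\in R_{ijm}$: $$\widehat p_{j/i}=\frac{e^{\widehat\theta_j(V_{ij}+S_{ij})}}{\sum_{j'\in J}e^{\widehat\theta_j(V_{ij'}+S_{ij'})}},\qquad \widehat p_{M/ij}=\frac{e^{IV^{ij}_M}}{\sum_{M'\in\mathcal{N}}e^{IV^{ij}_{M'}}},\qquad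 \widehat p^{\,ij}_{m/M}=\frac{e^{\widehat\theta_m(V_{ijm}+S_{ijm})/\widehat\tau_M}}{\sum_{m'\in M}e^{\widehat\theta_m(V_{ijm'}+S_{ijm'})/\widehat\tau_M}},$$ $$\widehat p_{r/ijm}=\frac{PS^{ijm}_re^{\theta_rV_{ijmr}}}{\sum_{r'\in R_{ijm}}PS^{ijm}_{r'}e^{\theta_rV_{ijmr'}}},$$ so that the mode choice probability is $\widehat p_{m/ij}=\widehat p_{M/ij}\,\widehat p^{\,ij}_{m/M}$ for $m\in M$.
   Context: **Sets.** $I$, $J$ are finite nonempty sets of origins and destinations. The finite set of modes is partitioned into nonempty nests, forming the set $\mathcal{N}$. Each mode $m$ has a network with finitely many links $a_m$ (also written $a$). $R_{ijm}$ is a finite nonempty set of routes from $i$ to $j$ on mode $m$. $\delta^{a_m}_{ijr}\in\{0,1\}$ is $1$ if link $a_m$ lies on route $r$ from $i$ to $j$ on mode $m$, and $0$ otherwise. **Data.** Positive total demands $\overline{O_i}$; positive observed trip numbers $\overline{T_{ij}}$ (from $i$ to $j$), $\overline{T_{ijM}}$ (using nest $M$), $\overline{T_{ijm}}$ (using mode $m$); real attributes $X^k_{ij}$ and $X^q_{ijm}$ (finitely many indices $k$ and $q$); $\theta_r>0$, a fixed constant (the subscripts in $\theta_j,\theta_m,\theta_r$ only name the choice level: destination, mode, route); and path-size factors $$PS^{ijm}_r=\sum_{a_m\in r}\frac{l_{a_m}}{L^{ijm}_r}\Big(\frac1{\sum_{r'\in R_{ijm}}\delta^{a_m}_{ijr'}}\Big),$$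 where $l_{a_m}>0$ is the length of link $a_m$ and $L^{ijm}_r$ is the length of route $r$. **Costs (standing assumption).** The generalized link cost $g^m_a$ is continuous, differentiable, strictly increasing and separable (it depends only on the flow $f^m_a$ of its own link and mode), and route costs are additive: $g_{ijmr}=\sum_{a_m}g^m_a(f^m_a)\,\delta^{a_m}_{ijr}$. **Problem FirstStage.** The variables are positive numbers $p_{j/i}$, $p_{M/ij}$, $p^{ij}_{m/M}$ ($m\in M$), $p_{r/ijm}$. Below, sums over $m$ appearing together with $M$ run over $m\in M$, and sums over $r$ run over $R_{ijm}$. Maximize $$-\frac1{\theta_r}\sum_{i,j,M,m,r}\overline{O_i}\,p_{j/i}\,p_{M/ij}\,p^{ij}_{m/M}\,p_{r/ijm}\ln\frac{p_{r/ijm}}{PS^{ijm}_r}-\sum_m\sum_{a_m}\int_0^{f^m_a}g^m_a(w)\,dw,$$ where, for $m\in M$, $f^m_a=\sum_{i,j,r}\overline{O_i}\,p_{j/i}\,p_{M/ij}\,p^{ij}_{m/M}\,p_{r/ijm}\,\delta^{a_m}_{ijr}$, subject to (R1) $-\sum_{i,j}\overline{O_i}\,p_{j/i}\ln p_{j/i}=-\sum_{i,j}\overline{T_{ij}}\ln(\overline{T_{ij}}/\overline{O_i})$; (R2) $-\sum_{i,j,M}\overline{O_i}\,p_{j/i}\,p_{M/ij}\ln p_{M/ij}=-\sum_{i,j,M}\overline{T_{ijM}}\ln(\overline{T_{ijM}}/\overline{T_{ij}})$; (R3) for each $M$: $-\sum_{i,j}\sum_{m\in M}\overline{O_i}\,p_{j/i}\,p_{M/ij}\,p^{ij}_{m/M}\ln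 p^{ij}_{m/M}=-\sum_{i,j}\sum_{m\in M}\overline{T_{ijm}}\ln(\overline{T_{ijm}}/\overline{T_{ijM}})$; (A1) for each $k$: $\sum_{i,j}\overline{O_i}\,p_{j/i}X^k_{ij}=\sum_{i,j}\overline{T_{ij}}X^k_{ij}$; (A2) for each $q$: $\sum_{i,j,M,m}\overline{O_i}\,p_{j/i}\,p_{M/ij}\,p^{ij}_{m/M}X^q_{ijm}=\sum_{i,j,m}\overline{T_{ijm}}X^q_{ijm}$; (P) $\sum_jp_{j/i}=1$ for all $i$; $\sum_Mp_{M/ij}=1$ for all $i,j$; $\sum_{m\in M}p^{ij}_{m/M}=1$ for all $i,j,M$; $\sum_rp_{r/ijm}=1$ for all $i,j,m$. **Multiplier convention.** The multipliers are $1/\theta_j$ for (R1), $1/\theta_m$ for (R2), $\tau_M/\theta_m$ for (R3), $\beta_k$ for (A1), $\beta_q$ for (A2), and $\lambda_i,\mu_{ij},\kappa_{ijM},\nu_{ijm}$ for the four families in (P). The Lagrangian is $$\mathcal{L}=(\text{objective})+\frac1{\theta_j}\big[\mathrm{lhs}(R1)-\mathrm{rhs}(R1)\big]+\frac1{\theta_m}\big[\mathrm{lhs}(R2)-\mathrm{rhs}(R2)\big]+\sum_M\frac{\tau_M}{\theta_m}\big[\mathrm{lhs}(R3)_M-\mathrm{rhs}(R3)_M\big]+\sum_k\beta_k\big[\mathrm{lhs}(A1)_k-\mathrm{rhs}(A1)_k\big]+\sum_q\beta_q\big[\mathrm{lhs}(A2)_q-\mathrm{rhs}(A2)_q\big]+\sum_i\lambda_i\Big[\sum_jp_{j/i}-1\Big]+\sum_{i,j}\mu_{ij}\Big[\sum_Mp_{M/ij}-1\Big]+\sum_{i,j,M}\kappa_{ijM}\Big[\sum_{m\in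 M}p^{ij}_{m/M}-1\Big]+\sum_{i,j,m}\nu_{ijm}\Big[\sum_rp_{r/ijm}-1\Big],$$ with the flows $f^m_a$ regarded as functions of the $p$'s. "Optimal dual solution" means multipliers for which the partial derivatives of $\mathcal{L}$ with respect to all the $p$'s vanish at the optimal primal solution. *)

theory Defs
  imports "HOL-Analysis.Analysis" "HOL-Library.Disjoint_Sets"
begin

text \<open>
  Type variables: \<open>'i\<close> origins, \<open>'j\<close> destinations, \<open>'m\<close> modes, \<open>'a\<close> links, \<open>'r\<close> routes,
  \<open>'k\<close> and \<open>'q\<close> the attribute indices. A nest is a set of modes. Links are named per mode,
  routes per triple of origin, destination and mode: the same \<open>r\<close> in \<open>routes D i j m\<close> and in
  \<open>routes D i' j' m'\<close> may stand for unrelated routes.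
\<close>

record ('i, 'j, 'm, 'a, 'r, 'k, 'q) travel_data =
  origins :: "'i set"
  dests :: "'j set"
  modes :: "'m set"
  nests :: "'m set set"
  links :: "'m \<Rightarrow> 'a set"
  routes :: "'i \<Rightarrow> 'j \<Rightarrow> 'm \<Rightarrow> 'r set"
  incidence :: "'i \<Rightarrow> 'j \<Rightarrow> 'm \<Rightarrow> 'r \<Rightarrow> 'a \<Rightarrow> real"
  demand :: "'i \<Rightarrow> real"
  trips :: "'i \<Rightarrow> 'j \<Rightarrow> real"
  trips_nest :: "'i \<Rightarrow> 'j \<Rightarrow> 'm set \<Rightarrow> real"
  trips_mode :: "'i \<Rightarrow> 'j \<Rightarrow> 'm \<Rightarrow> real"
  attrs_dest :: "'k set"
  attrs_mode :: "'q set"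
  attr_dest :: "'k \<Rightarrow> 'i \<Rightarrow> 'j \<Rightarrow> real"
  attr_mode :: "'q \<Rightarrow> 'i \<Rightarrow> 'j \<Rightarrow> 'm \<Rightarrow> real"
  theta_route :: real
  link_length :: "'m \<Rightarrow> 'a \<Rightarrow> real"
  link_cost :: "'m \<Rightarrow> 'a \<Rightarrow> real \<Rightarrow> real"

text \<open>
  Link flows are nonnegative, so the regularity of a link cost is required on \<open>{0..}\<close> only.
  That every route has at least one link is what makes the path-size factors well defined and
  positive.
\<close>

definition valid_data :: "('i, 'j, 'm, 'a, 'r, 'k, 'q) travel_data \<Rightarrow> bool" where
  "valid_data D \<longleftrightarrow>
     finite (origins D) \<and> origins D \<noteq> {} \<and>
     finite (dests D) \<and> dests D \<noteq> {} \<and>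
     finite (modes D) \<and> partition_on (modes D) (nests D) \<and>
     (\<forall>m\<in>modes D. finite (links D m)) \<and>
     (\<forall>i\<in>origins D. \<forall>j\<in>dests D. \<forall>m\<in>modes D.
        finite (routes D i j m) \<and> routes D i j m \<noteq> {} \<and>
        (\<forall>r\<in>routes D i j m.
           (\<forall>a\<in>links D m. incidence D i j m r a \<in> {0, 1}) \<and>
           (\<exists>a\<in>links D m. incidence D i j m r a = 1))) \<and>
     (\<forall>i\<in>origins D. demand D i > 0) \<and>
     (\<forall>i\<in>origins D. \<forall>j\<in>dests D. trips D i j > 0) \<and>
     (\<forall>i\<in>origins D. \<forall>j\<in>dests D. \<forall>M\<in>nests D. trips_nest D i j M > 0) \<and>
     (\<forall>i\<in>origins D. \<forall>j\<in>dests D. \<forall>m\<in>modes D. trips_mode D i j m > 0) \<and>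
     finite (attrs_dest D) \<and> finite (attrs_mode D) \<and>
     theta_route D > 0 \<and>
     (\<forall>m\<in>modes D. \<forall>a\<in>links D m.
        link_length D m a > 0 \<and>
        continuous_on {0..} (link_cost D m a) \<and>
        link_cost D m a differentiable_on {0..} \<and>
        strict_mono_on {0..} (link_cost D m a))"

definition route_length where
  "route_length D i j m r = (\<Sum>a\<in>links D m. incidence D i j m r a * link_length D m a)"

definition path_size where
  "path_size D i j m r =
     (\<Sum>a\<in>{a \<in> links D m. incidence D i j m r a = 1}.
        link_length D m a / route_length D i j m r *
        (1 / (\<Sum>r'\<in>routes D i j m. incidence D i j m r' a)))"

text \<open>
  The variables: \<open>p_dest p (i, j)\<close> is $p_{j/i}$, \<open>p_nest p (i, j, M)\<close> is $p_{M/ij}$,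
  \<open>p_mode p (i, j, M, m)\<close> is $p^{ij}_{m/M}$ (only used for $m \in M$), and
  \<open>p_route p (i, j, m, r)\<close> is $p_{r/ijm}$.
\<close>

record ('i, 'j, 'm, 'r) choice_probs =
  p_dest :: "'i \<times> 'j \<Rightarrow> real"
  p_nest :: "'i \<times> 'j \<times> 'm set \<Rightarrow> real"
  p_mode :: "'i \<times> 'j \<times> 'm set \<times> 'm \<Rightarrow> real"
  p_route :: "'i \<times> 'j \<times> 'm \<times> 'r \<Rightarrow> real"

definition nest_of where
  "nest_of D m = (THE M. M \<in> nests D \<and> m \<in> M)"

definition link_flow where
  "link_flow D p m a =
     (\<Sum>i\<in>origins D. \<Sum>j\<in>dests D. \<Sum>r\<in>routes D i j m.
        demand D i * p_dest p (i, j) * p_nest p (i, j, nest_of D m) *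
        p_mode p (i, j, nest_of D m, m) * p_route p (i, j, m, r) * incidence D i j m r a)"

definition route_cost where
  "route_cost D p i j m r =
     (\<Sum>a\<in>links D m. link_cost D m a (link_flow D p m a) * incidence D i j m r a)"

definition objective where
  "objective D p =
     - (1 / theta_route D) *
       (\<Sum>i\<in>origins D. \<Sum>j\<in>dests D. \<Sum>M\<in>nests D. \<Sum>m\<in>M. \<Sum>r\<in>routes D i j m.
          demand D i * p_dest p (i, j) * p_nest p (i, j, M) * p_mode p (i, j, M, m) *
          p_route p (i, j, m, r) * ln (p_route p (i, j, m, r) / path_size D i j m r))
     - (\<Sum>m\<in>modes D. \<Sum>a\<in>links D m. integral {0..link_flow D p m a} (link_cost D m a))"

definition entropy_dest where
  "entropy_dest D p =
     - (\<Sum>i\<in>origins D. \<Sum>j\<in>dests D. demand D i * p_dest p (i, j) * ln (p_dest p (i, j)))"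

definition entropy_nest where
  "entropy_nest D p =
     - (\<Sum>i\<in>origins D. \<Sum>j\<in>dests D. \<Sum>M\<in>nests D.
          demand D i * p_dest p (i, j) * p_nest p (i, j, M) * ln (p_nest p (i, j, M)))"

definition entropy_mode where
  "entropy_mode D p M =
     - (\<Sum>i\<in>origins D. \<Sum>j\<in>dests D. \<Sum>m\<in>M.
          demand D i * p_dest p (i, j) * p_nest p (i, j, M) * p_mode p (i, j, M, m) *
          ln (p_mode p (i, j, M, m)))"

definition total_attr_dest where
  "total_attr_dest D p k =
     (\<Sum>i\<in>origins D. \<Sum>j\<in>dests D. demand D i * p_dest p (i, j) * attr_dest D k i j)"

definition total_attr_mode where
  "total_attr_mode D p q =
     (\<Sum>i\<in>origins D. \<Sum>j\<in>dests D. \<Sum>M\<in>nests D. \<Sum>m\<in>M.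
        demand D i * p_dest p (i, j) * p_nest p (i, j, M) * p_mode p (i, j, M, m) *
        attr_mode D q i j m)"

definition obs_entropy_dest where
  "obs_entropy_dest D =
     - (\<Sum>i\<in>origins D. \<Sum>j\<in>dests D. trips D i j * ln (trips D i j / demand D i))"

definition obs_entropy_nest where
  "obs_entropy_nest D =
     - (\<Sum>i\<in>origins D. \<Sum>j\<in>dests D. \<Sum>M\<in>nests D.
          trips_nest D i j M * ln (trips_nest D i j M / trips D i j))"

definition obs_entropy_mode where
  "obs_entropy_mode D M =
     - (\<Sum>i\<in>origins D. \<Sum>j\<in>dests D. \<Sum>m\<in>M.
          trips_mode D i j m * ln (trips_mode D i j m / trips_nest D i j M))"

definition obs_attr_dest where
  "obs_attr_dest D k = (\<Sum>i\<in>origins D. \<Sum>j\<in>dests D. trips D i j * attr_dest D k i j)"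

definition obs_attr_mode where
  "obs_attr_mode D q =
     (\<Sum>i\<in>origins D. \<Sum>j\<in>dests D. \<Sum>m\<in>modes D. trips_mode D i j m * attr_mode D q i j m)"

definition positive_probs where
  "positive_probs D p \<longleftrightarrow>
     (\<forall>i\<in>origins D. \<forall>j\<in>dests D.
        p_dest p (i, j) > 0 \<and>
        (\<forall>M\<in>nests D. p_nest p (i, j, M) > 0 \<and> (\<forall>m\<in>M. p_mode p (i, j, M, m) > 0)) \<and>
        (\<forall>m\<in>modes D. \<forall>r\<in>routes D i j m. p_route p (i, j, m, r) > 0))"

definition feasible where
  "feasible D p \<longleftrightarrow>
     positive_probs D p \<and>
     entropy_dest D p = obs_entropy_dest D \<and>
     entropy_nest D p = obs_entropy_nest D \<and>
     (\<forall>M\<in>nests D. entropy_mode D p M = obs_entropy_mode D M) \<and>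
     (\<forall>k\<in>attrs_dest D. total_attr_dest D p k = obs_attr_dest D k) \<and>
     (\<forall>q\<in>attrs_mode D. total_attr_mode D p q = obs_attr_mode D q) \<and>
     (\<forall>i\<in>origins D. (\<Sum>j\<in>dests D. p_dest p (i, j)) = 1) \<and>
     (\<forall>i\<in>origins D. \<forall>j\<in>dests D. (\<Sum>M\<in>nests D. p_nest p (i, j, M)) = 1) \<and>
     (\<forall>i\<in>origins D. \<forall>j\<in>dests D. \<forall>M\<in>nests D. (\<Sum>m\<in>M. p_mode p (i, j, M, m)) = 1) \<and>
     (\<forall>i\<in>origins D. \<forall>j\<in>dests D. \<forall>m\<in>modes D.
        (\<Sum>r\<in>routes D i j m. p_route p (i, j, m, r)) = 1)"

definition optimal_primal where
  "optimal_primal D p \<longleftrightarrow> is_arg_max (objective D) (feasible D) p"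

record ('i, 'j, 'm, 'k, 'q) multipliers =
  mult_entropy_dest :: real
  mult_entropy_nest :: real
  mult_entropy_mode :: "'m set \<Rightarrow> real"
  mult_attr_dest :: "'k \<Rightarrow> real"
  mult_attr_mode :: "'q \<Rightarrow> real"
  mult_sum_dest :: "'i \<Rightarrow> real"
  mult_sum_nest :: "'i \<Rightarrow> 'j \<Rightarrow> real"
  mult_sum_mode :: "'i \<Rightarrow> 'j \<Rightarrow> 'm set \<Rightarrow> real"
  mult_sum_route :: "'i \<Rightarrow> 'j \<Rightarrow> 'm \<Rightarrow> real"

definition lagrangian where
  "lagrangian D w p =
     objective D p
     + mult_entropy_dest w * (entropy_dest D p - obs_entropy_dest D)
     + mult_entropy_nest w * (entropy_nest D p - obs_entropy_nest D)
     + (\<Sum>M\<in>nests D. mult_entropy_mode w M * (entropy_mode D p M - obs_entropy_mode D M))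
     + (\<Sum>k\<in>attrs_dest D. mult_attr_dest w k * (total_attr_dest D p k - obs_attr_dest D k))
     + (\<Sum>q\<in>attrs_mode D. mult_attr_mode w q * (total_attr_mode D p q - obs_attr_mode D q))
     + (\<Sum>i\<in>origins D. mult_sum_dest w i * ((\<Sum>j\<in>dests D. p_dest p (i, j)) - 1))
     + (\<Sum>i\<in>origins D. \<Sum>j\<in>dests D.
          mult_sum_nest w i j * ((\<Sum>M\<in>nests D. p_nest p (i, j, M)) - 1))
     + (\<Sum>i\<in>origins D. \<Sum>j\<in>dests D. \<Sum>M\<in>nests D.
          mult_sum_mode w i j M * ((\<Sum>m\<in>M. p_mode p (i, j, M, m)) - 1))
     + (\<Sum>i\<in>origins D. \<Sum>j\<in>dests D. \<Sum>m\<in>modes D.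
          mult_sum_route w i j m * ((\<Sum>r\<in>routes D i j m. p_route p (i, j, m, r)) - 1))"

text \<open>All partial derivatives of the Lagrangian with respect to the variables vanish at \<open>p\<close>.\<close>

definition optimal_dual where
  "optimal_dual D p w \<longleftrightarrow>
     (\<forall>i\<in>origins D. \<forall>j\<in>dests D.
        ((\<lambda>x. lagrangian D w (p\<lparr>p_dest := (p_dest p)((i, j) := x)\<rparr>))
          has_real_derivative 0) (at (p_dest p (i, j)))) \<and>
     (\<forall>i\<in>origins D. \<forall>j\<in>dests D. \<forall>M\<in>nests D.
        ((\<lambda>x. lagrangian D w (p\<lparr>p_nest := (p_nest p)((i, j, M) := x)\<rparr>))
          has_real_derivative 0) (at (p_nest p (i, j, M)))) \<and>
     (\<forall>i\<in>origins D. \<forall>j\<in>dests D. \<forall>M\<in>nests D. \<forall>m\<in>M.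
        ((\<lambda>x. lagrangian D w (p\<lparr>p_mode := (p_mode p)((i, j, M, m) := x)\<rparr>))
          has_real_derivative 0) (at (p_mode p (i, j, M, m)))) \<and>
     (\<forall>i\<in>origins D. \<forall>j\<in>dests D. \<forall>m\<in>modes D. \<forall>r\<in>routes D i j m.
        ((\<lambda>x. lagrangian D w (p\<lparr>p_route := (p_route p)((i, j, m, r) := x)\<rparr>))
          has_real_derivative 0) (at (p_route p (i, j, m, r))))"

text \<open>The mode choice probability $p_{m/ij}$, by the law of total probability over the nests.\<close>

definition mode_choice_prob where
  "mode_choice_prob D p i j m =
     (\<Sum>M\<in>{M \<in> nests D. m \<in> M}. p_nest p (i, j, M) * p_mode p (i, j, M, m))"

end

theory Submission
  imports Defs
begin

text \<open>
  At the optimum each integrated link cost has the same first-order variation as its linearization,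
  so up to a term with zero derivative the Lagrangian is a nested sum: every choice level contributes
  \<open>p * (u - b * ln (p / w))\<close>, where \<open>u\<close> is the expected value of the level below plus the
  attribute utility (at the route level, minus the route cost). Stationarity at one level forces
  logit probabilities with scale \<open>1 / b\<close>, and the expected value of that level then collapses to
  the logsum \<open>b * ln (\<Sum> w * exp (u / b))\<close>. Going up from routes to modes, nests and
  destinations turns these logsums into \<open>S_mode\<close>, \<open>IV\<close> (over \<open>\<theta>\<^sub>m\<close>) and \<open>S_dest\<close>.
\<close>

section \<open>Stationarity of a single choice level\<close>

text \<open>A partial derivative of a nested sum meets its variable in one summand per index; the
  other summands are frozen at their value at \<open>x\<close>.\<close>

lemma DERIV_sum_single:
  fixes f :: "'b \<Rightarrow> real \<Rightarrow> real"
  assumes "finite A" "a \<in> A" "(f a has_real_derivative d) (at x)"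
    and "\<And>b y. b \<in> A \<Longrightarrow> b \<noteq> a \<Longrightarrow> f b y = f b x"
  shows "((\<lambda>y. \<Sum>b\<in>A. f b y) has_real_derivative d) (at x)"
proof -
  have "(\<Sum>b\<in>A. f b y) = f a y + (\<Sum>b\<in>A - {a}. f b x)" for y
    unfolding sum.remove[OF assms(1,2)] by (intro arg_cong2[of _ _ _ _ "(+)"] refl sum.cong) (use assms(4) in blast)
  then show ?thesis
    using assms(3) by (auto intro!: derivative_eq_intros)
qed

text \<open>The common form of a choice level: \<open>w\<close> is the path-size factor for routes
  and 1 at the other levels. The \<open>+ 1\<close> comes from differentiating
  \<open>y * ln y\<close> and is the same for all alternatives.\<close>

lemma DERIV_entropy_term:
  fixes x u b w :: real
  assumes "x > 0" "w > 0"
  shows "((\<lambda>y. y * (u - b * ln (y / w))) has_real_derivative u - b * (ln (x / w) + 1)) (at x)"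
  using assms by (auto intro!: derivative_eq_intros simp: field_simps)

text \<open>Stationarity makes \<open>ln (p a / w a) - u a / b\<close> independent of the
  alternative, and normalization then fixes this constant as minus the logarithm of the logit
  denominator. Here \<open>c\<close> stands for the probability weight of reaching the level and
  \<open>l\<close> for the multiplier of its normalization constraint.\<close>

lemma entropy_stationary:
  fixes p u w :: "'b \<Rightarrow> real" and b c l :: real
  assumes "b > 0" "c > 0" "finite A"
    and pos: "\<And>a. a \<in> A \<Longrightarrow> p a > 0" "\<And>a. a \<in> A \<Longrightarrow> w a > 0"
    and sum1: "(\<Sum>a\<in>A. p a) = 1"
    and stat: "\<And>a. a \<in> A \<Longrightarrow> c * (u a - b * (ln (p a / w a) + 1)) + l = 0"
  shows "a \<in> A \<Longrightarrow> p a = w a * exp (u a / b) / (\<Sum>a\<in>A. w a * exp (u a / b))"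
    and "(\<Sum>a\<in>A. p a * (u a - b * ln (p a / w a))) = b * ln (\<Sum>a\<in>A. w a * exp (u a / b))"
proof -
  \<comment> \<open>Chosen so that solving \<open>stat\<close> for the logarithm gives
    \<open>u a / b - K\<close>.\<close>
  define K where "K = 1 - l / (b * c)"
  let ?Z = "\<Sum>a\<in>A. w a * exp (u a / b)"
  have lnp: "ln (p a / w a) = u a / b - K" if "a \<in> A" for a
  proof -
    have "u a - b * (ln (p a / w a) + 1) = - l / c"
      using stat[OF that] \<open>c > 0\<close> by (simp add: field_simps)
    then show ?thesis
      using \<open>b > 0\<close> \<open>c > 0\<close> unfolding K_def by (simp add: field_simps)
  qed
  have p: "p a = w a * exp (u a / b) * exp (- K)" if "a \<in> A" for a
  proof -
    have "p a / w a = exp (u a / b - K)"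
      using lnp[OF that] pos[OF that] by (metis divide_pos_pos exp_ln)
    then show ?thesis
      using pos(2)[OF that] by (simp add: exp_diff exp_minus field_simps)
  qed
  have "1 = ?Z * exp (- K)"
    using sum1 p by (simp add: sum_distrib_right)
  then have Z: "?Z = exp K"
    by (simp add: exp_minus field_simps)
  show "p a = w a * exp (u a / b) / ?Z" if "a \<in> A" for a
    unfolding Z using p[OF that] by (simp add: exp_minus divide_inverse)
  \<comment> \<open>All alternatives have the same net value \<open>b * K\<close>, hence so does
    their average.\<close>
  have "(\<Sum>a\<in>A. p a * (u a - b * ln (p a / w a))) = (\<Sum>a\<in>A. p a * (b * K))"
    using \<open>b > 0\<close> by (intro sum.cong refl) (simp add: lnp algebra_simps)
  also have "\<dots> = b * K"
    by (simp add: sum_distrib_right[symmetric] sum1)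
  finally show "(\<Sum>a\<in>A. p a * (u a - b * ln (p a / w a))) = b * ln ?Z"
    unfolding Z by simp
qed

section \<open>The Lagrangian as a nested sum of level values\<close>

definition dest_utility where
  "dest_utility D w i j = (\<Sum>k\<in>attrs_dest D. mult_attr_dest w k * attr_dest D k i j)"

definition mode_utility where
  "mode_utility D w i j m = (\<Sum>k\<in>attrs_mode D. mult_attr_mode w k * attr_mode D k i j m)"

text \<open>The route costs are frozen at \<open>p\<close> while the probabilities come from
  \<open>q\<close>, so that varying \<open>q\<close> does not move the costs. At a stationary point
  with \<open>q = p\<close> the value is the logsum \<open>S_mode\<close>.\<close>

definition route_val where
  "route_val D p q i j m =
     (\<Sum>r\<in>routes D i j m. p_route q (i, j, m, r) *
        (- route_cost D p i j m r - 1 / theta_route D * ln (p_route q (i, j, m, r) / path_size D i j m r)))"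

text \<open>At a stationary point with \<open>q = p\<close> this is the inclusive value divided by
  \<open>\<theta>\<^sub>m\<close>, since the entropy multiplier of a nest is
  \<open>\<tau> M / \<theta>\<^sub>m\<close>.\<close>

definition mode_val where
  "mode_val D w p q i j M =
     (\<Sum>m\<in>M. p_mode q (i, j, M, m) *
        (mode_utility D w i j m + route_val D p q i j m
           - mult_entropy_mode w M * ln (p_mode q (i, j, M, m))))"

definition nest_val where
  "nest_val D w p q i j =
     (\<Sum>M\<in>nests D. p_nest q (i, j, M) *
        (mode_val D w p q i j M - mult_entropy_nest w * ln (p_nest q (i, j, M))))"

definition total_val where
  "total_val D w p q =
     (\<Sum>i\<in>origins D. \<Sum>j\<in>dests D. demand D i * (p_dest q (i, j) *
        (dest_utility D w i j + nest_val D w p q i j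
           - mult_entropy_dest w * ln (p_dest q (i, j)))))"

text \<open>The constants \<open>- 1\<close> of the constraints are left out; they go into the
  additive constant of \<open>lagrangian_eq\<close>.\<close>

definition normalization_terms where
  "normalization_terms D w q =
     (\<Sum>i\<in>origins D. mult_sum_dest w i * (\<Sum>j\<in>dests D. p_dest q (i, j)))
     + (\<Sum>i\<in>origins D. \<Sum>j\<in>dests D. mult_sum_nest w i j * (\<Sum>M\<in>nests D. p_nest q (i, j, M)))
     + (\<Sum>i\<in>origins D. \<Sum>j\<in>dests D. \<Sum>M\<in>nests D.
          mult_sum_mode w i j M * (\<Sum>m\<in>M. p_mode q (i, j, M, m)))
     + (\<Sum>i\<in>origins D. \<Sum>j\<in>dests D. \<Sum>m\<in>modes D.
          mult_sum_route w i j m * (\<Sum>r\<in>routes D i j m. p_route q (i, j, m, r)))"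

text \<open>
  The error made by replacing the integrated link costs at \<open>q\<close> by their linearization at \<open>p\<close>;
  it has a critical point at \<open>q = p\<close>.
\<close>

definition cost_residual where
  "cost_residual D p q =
     (\<Sum>m\<in>modes D. \<Sum>a\<in>links D m.
        integral {0..link_flow D q m a} (link_cost D m a)
        - link_cost D m a (link_flow D p m a) * link_flow D q m a)"

section \<open>Consequences of the assumptions on the data\<close>

lemma valid_dataD:
  assumes "valid_data D"
  shows "finite (origins D)" "finite (dests D)" "finite (modes D)"
    "partition_on (modes D) (nests D)" "theta_route D > 0"
    "i \<in> origins D \<Longrightarrow> demand D i > 0"
    "m \<in> modes D \<Longrightarrow> finite (links D m)"
    "m \<in> modes D \<Longrightarrow> a \<in> links D m \<Longrightarrow> link_length D m a > 0"
    "m \<in> modes D \<Longrightarrow> a \<in> links D m \<Longrightarrow> continuous_on {0..} (link_cost D m a)"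
  using assms unfolding valid_data_def by blast+

lemma valid_data_routesD:
  assumes "valid_data D" "i \<in> origins D" "j \<in> dests D" "m \<in> modes D"
  shows "finite (routes D i j m)"
    "r \<in> routes D i j m \<Longrightarrow> \<exists>a\<in>links D m. incidence D i j m r a = 1"
    "r \<in> routes D i j m \<Longrightarrow> a \<in> links D m \<Longrightarrow> incidence D i j m r a \<noteq> 0 \<Longrightarrow> incidence D i j m r a = 1"
  using assms unfolding valid_data_def by blast+

lemma nest_of_eq:
  assumes "valid_data D" "M \<in> nests D" "m \<in> M"
  shows "nest_of D m = M"
  unfolding nest_of_def
proof (rule the_equality)
  fix N assume "N \<in> nests D \<and> m \<in> N"
  then show "N = M"
    using assms(2,3) valid_dataD(4)[OF assms(1)] unfolding partition_on_def disjoint_def by blast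
qed (use assms in auto)

lemma nest_subset_modes:
  assumes "valid_data D" "M \<in> nests D"
  shows "M \<subseteq> modes D"
  using valid_dataD(4)[OF assms(1)] assms(2) by (auto simp: partition_on_def)

lemma finite_nest:
  assumes "valid_data D" "M \<in> nests D"
  shows "finite M"
  using nest_subset_modes[OF assms] valid_dataD(3)[OF assms(1)] by (rule finite_subset)

lemma finite_nests:
  assumes "valid_data D"
  shows "finite (nests D)"
  using valid_dataD(3,4)[OF assms] by (rule finite_elements)

text \<open>The nests partition the modes, so every mode is met exactly once. This links the flows,
  which are indexed by modes, to the entropy sums, which are indexed by nests.\<close>

lemma sum_nests:
  assumes "valid_data D"
  shows "(\<Sum>M\<in>nests D. \<Sum>m\<in>M. f M m) = (\<Sum>m\<in>modes D. f (nest_of D m) m)"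
proof -
  have "modes D = \<Union>(nests D)" and disj: "disjoint (nests D)"
    using valid_dataD(4)[OF assms] by (simp_all add: partition_on_def)
  then have "(\<Sum>m\<in>modes D. f (nest_of D m) m) = (\<Sum>m\<in>\<Union>(nests D). f (nest_of D m) m)"
    by simp
  also have "\<dots> = (\<Sum>M\<in>nests D. \<Sum>m\<in>M. f (nest_of D m) m)"
    using disj finite_nest[OF assms]
    by (subst sum.Union_disjoint) (simp_all add: disjoint_def)
  also have "\<dots> = (\<Sum>M\<in>nests D. \<Sum>m\<in>M. f M m)"
    using nest_of_eq[OF assms] by (intro sum.cong) auto
  finally show ?thesis ..
qed

text \<open>A route has a link, so its length is positive; and it is itself counted among the routes
  through each of its links, so no denominator vanishes. Positivity makes \<open>ln (p / PS)\<close>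
  differentiable.\<close>

lemma path_size_pos:
  assumes "valid_data D" "i \<in> origins D" "j \<in> dests D" "m \<in> modes D" "r \<in> routes D i j m"
  shows "path_size D i j m r > 0"
proof -
  note routes = valid_data_routesD[OF assms(1-4)]
  have inc: "incidence D i j m r' a \<ge> 0" if "r' \<in> routes D i j m" "a \<in> links D m" for r' a
    using routes(3)[OF that] by fastforce
  note fin = valid_dataD(7)[OF assms(1,4)] and len = valid_dataD(8)[OF assms(1,4)]
  obtain a where a: "a \<in> links D m" "incidence D i j m r a = 1"
    using routes(2)[OF assms(5)] by blast
  have L: "route_length D i j m r > 0"
    unfolding route_length_def
  proof (rule sum_pos2[OF fin a(1)])
    show "0 < incidence D i j m r a * link_length D m a"
      using a len by simp
    show "0 \<le> incidence D i j m r b * link_length D m b" if "b \<in> links D m" for b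
      using inc[OF assms(5) that] len[OF that] by simp
  qed
  have count: "(\<Sum>r'\<in>routes D i j m. incidence D i j m r' b) > 0"
    if "b \<in> links D m" "incidence D i j m r b = 1" for b
    by (rule sum_pos2[OF routes(1) assms(5)]) (use that inc in auto)
  show ?thesis
    unfolding path_size_def
  proof (rule sum_pos)
    show "finite {a \<in> links D m. incidence D i j m r a = 1}"
      using fin by simp
    show "{a \<in> links D m. incidence D i j m r a = 1} \<noteq> {}"
      using a by blast
    show "0 < link_length D m b / route_length D i j m r *
        (1 / (\<Sum>r'\<in>routes D i j m. incidence D i j m r' b))"
      if "b \<in> {a \<in> links D m. incidence D i j m r a = 1}" for b
      using that L count[of b] len[of b] by simp
  qed
qed

section \<open>Link flows and the derivative of the cost integrals\<close>

text \<open>The map \<open>x \<mapsto> integral {0..x} g\<close> is constantly 0 for negative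
  \<open>x\<close>, so it may have a kink at 0. A link on some route carries positive flow because
  all probabilities are positive, which avoids the kink; a link on no route has zero flow for every
  \<open>q\<close>, so nothing varies.\<close>

lemma link_flow_pos_or_unused:
  fixes D :: "('i, 'j, 'm, 'a, 'r, 'k, 'q) travel_data"
    and p :: "('i, 'j, 'm, 'r) choice_probs"
  assumes D: "valid_data D" and p: "positive_probs D p" and m: "m \<in> modes D" "a \<in> links D m"
  obtains "link_flow D p m a > 0" | "\<And>q :: ('i, 'j, 'm, 'r) choice_probs. link_flow D q m a = 0"
proof (cases "\<exists>i\<in>origins D. \<exists>j\<in>dests D. \<exists>r\<in>routes D i j m. incidence D i j m r a \<noteq> 0")
  case False
  then have "link_flow D q m a = 0" for q :: "('i, 'j, 'm, 'r) choice_probs"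
    unfolding link_flow_def by (intro sum.neutral ballI) simp
  then show thesis using that by blast
next
  case True
  then obtain i j r where i: "i \<in> origins D" and j: "j \<in> dests D" and r: "r \<in> routes D i j m"
    and inc1: "incidence D i j m r a \<noteq> 0" by blast
  let ?M = "nest_of D m"
  obtain M where "M \<in> nests D" "m \<in> M"
    using valid_dataD(4)[OF D] m(1) unfolding partition_on_def by blast
  then have M: "?M \<in> nests D" "m \<in> ?M"
    using nest_of_eq[OF D] by simp_all
  define t where "t = (\<lambda>i j r. demand D i * p_dest p (i, j) * p_nest p (i, j, ?M) *
    p_mode p (i, j, ?M, m) * p_route p (i, j, m, r) * incidence D i j m r a)"
  have pos: "t i j r > 0"
    if ijr: "i \<in> origins D" "j \<in> dests D" "r \<in> routes D i j m" "incidence D i j m r a \<noteq> 0" for i j r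
  proof -
    have "p_dest p (i, j) > 0" "p_nest p (i, j, ?M) > 0" "p_mode p (i, j, ?M, m) > 0"
      "p_route p (i, j, m, r) > 0"
      using ijr p m M unfolding positive_probs_def by blast+
    then show ?thesis
      unfolding t_def
      using valid_dataD(6)[OF D ijr(1)] valid_data_routesD(3)[OF D ijr(1,2) m(1) ijr(3) m(2) ijr(4)]
      by simp
  qed
  \<comment> \<open>Routes avoiding the link contribute 0, so the single positive term of the chosen
    route makes the total positive.\<close>
  have nn: "0 \<le> t i j r" if "i \<in> origins D" "j \<in> dests D" "r \<in> routes D i j m" for i j r
    using pos[OF that] by (cases "incidence D i j m r a = 0") (simp_all add: t_def)
  have "0 < (\<Sum>r\<in>routes D i j m. t i j r)"
    using valid_data_routesD(1)[OF D i j m(1)] r pos[OF i j r inc1] by (rule sum_pos2) (rule nn[OF i j])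
  then have "0 < (\<Sum>j\<in>dests D. \<Sum>r\<in>routes D i j m. t i j r)"
    by (rule sum_pos2[OF valid_dataD(2)[OF D] j]) (intro sum_nonneg nn i)
  then have "0 < (\<Sum>i\<in>origins D. \<Sum>j\<in>dests D. \<Sum>r\<in>routes D i j m. t i j r)"
    by (rule sum_pos2[OF valid_dataD(1)[OF D] i]) (intro sum_nonneg nn)
  then show thesis using that unfolding link_flow_def t_def by blast
qed

text \<open>The fundamental theorem gives the derivative within an interval; ending the interval at
  \<open>u + 1\<close> puts \<open>u\<close> in its interior, so the derivative is
  two-sided.\<close>

lemma integral_DERIV_interior:
  fixes g :: "real \<Rightarrow> real"
  assumes "continuous_on {0..} g" "u > 0"
  shows "((\<lambda>x. integral {0..x} g) has_real_derivative g u) (at u)"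
proof -
  have "continuous_on {0..u+1} g"
    using assms(1) by (rule continuous_on_subset) auto
  then have "((\<lambda>x. integral {0..x} g) has_real_derivative g u) (at u within {0..u+1})"
    by (rule integral_has_real_derivative) (use assms in auto)
  moreover have "at u within {0..u+1} = at u"
    by (rule at_within_interior) (use assms in auto)
  ultimately show ?thesis by simp
qed

text \<open>By the chain rule the integral and the linear term both contribute the link cost at
  \<open>p\<close> times the derivative of the flow, and these cancel because
  \<open>c x = p\<close>. Working along a curve \<open>c\<close> covers the four families of partial
  derivatives at once.\<close>

lemma cost_residual_DERIV:
  fixes D :: "('i, 'j, 'm, 'a, 'r, 'k, 'q) travel_data"
    and p :: "('i, 'j, 'm, 'r) choice_probs"
  assumes D: "valid_data D" and pp: "positive_probs D p" and c: "c x = p"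
    and diff: "\<And>k. (\<lambda>y. p_dest (c y) k) field_differentiable (at x)"
      "\<And>k. (\<lambda>y. p_nest (c y) k) field_differentiable (at x)"
      "\<And>k. (\<lambda>y. p_mode (c y) k) field_differentiable (at x)"
      "\<And>k. (\<lambda>y. p_route (c y) k) field_differentiable (at x)"
  shows "((\<lambda>y. cost_residual D p (c y)) has_real_derivative 0) (at x)"
proof -
  have "((\<lambda>y. integral {0..link_flow D (c y) m a} (link_cost D m a)
        - link_cost D m a (link_flow D p m a) * link_flow D (c y) m a) has_real_derivative 0) (at x)"
    if m: "m \<in> modes D" "a \<in> links D m" for m a
    using D pp m
  proof (cases rule: link_flow_pos_or_unused)
    case 1
    have "(\<lambda>y. link_flow D (c y) m a) field_differentiable (at x)"
      unfolding link_flow_def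
      by (intro field_differentiable_sum field_differentiable_mult diff field_differentiable_const)
    then obtain d where d: "((\<lambda>y. link_flow D (c y) m a) has_real_derivative d) (at x)"
      unfolding field_differentiable_def by blast
    from DERIV_chain2[OF integral_DERIV_interior[OF valid_dataD(9)[OF D m]] d] 1 c
    have "((\<lambda>y. integral {0..link_flow D (c y) m a} (link_cost D m a)) has_real_derivative
        link_cost D m a (link_flow D p m a) * d) (at x)"
      by simp
    from DERIV_diff[OF this DERIV_cmult[OF d, of "link_cost D m a (link_flow D p m a)"]] show ?thesis by simp
  next
    case 2
    then show ?thesis by simp
  qed
  then have "((\<lambda>y. \<Sum>m\<in>modes D. \<Sum>a\<in>links D m. integral {0..link_flow D (c y) m a} (link_cost D m a)
        - link_cost D m a (link_flow D p m a) * link_flow D (c y) m a) has_real_derivative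
        (\<Sum>m\<in>modes D. \<Sum>a\<in>links D m. 0)) (at x)"
    by (intro DERIV_sum) auto
  then show ?thesis
    by (simp add: cost_residual_def)
qed

section \<open>Rewriting the Lagrangian\<close>

text \<open>Additivity of route costs: expanding the flows and exchanging the sums over links and
  routes collects the link costs along each route. Costs are taken at \<open>p\<close>, flows at
  \<open>q\<close>.\<close>

lemma link_costs_eq_route_costs:
  assumes "valid_data D"
  shows "(\<Sum>m\<in>modes D. \<Sum>a\<in>links D m. link_cost D m a (link_flow D p m a) * link_flow D q m a)
    = (\<Sum>i\<in>origins D. \<Sum>j\<in>dests D. \<Sum>M\<in>nests D. \<Sum>m\<in>M. \<Sum>r\<in>routes D i j m.
        demand D i * p_dest q (i, j) * p_nest q (i, j, M) * p_mode q (i, j, M, m) *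
        p_route q (i, j, m, r) * route_cost D p i j m r)"
proof -
  define T where "T = (\<lambda>i j m r. demand D i * p_dest q (i, j) * p_nest q (i, j, nest_of D m) *
    p_mode q (i, j, nest_of D m, m) * p_route q (i, j, m, r))"
  define g where "g = (\<lambda>m a. link_cost D m a (link_flow D p m a))"
  have "(\<Sum>a\<in>links D m. g m a * link_flow D q m a)
      = (\<Sum>i\<in>origins D. \<Sum>j\<in>dests D. \<Sum>r\<in>routes D i j m. T i j m r * route_cost D p i j m r)" for m
  proof -
    have "(\<Sum>a\<in>links D m. g m a * link_flow D q m a)
        = (\<Sum>a\<in>links D m. \<Sum>i\<in>origins D. \<Sum>j\<in>dests D. \<Sum>r\<in>routes D i j m.
            T i j m r * (g m a * incidence D i j m r a))"
      by (simp add: link_flow_def T_def sum_distrib_left mult_ac)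
    also have "\<dots> = (\<Sum>i\<in>origins D. \<Sum>a\<in>links D m. \<Sum>j\<in>dests D. \<Sum>r\<in>routes D i j m.
            T i j m r * (g m a * incidence D i j m r a))"
      by (rule sum.swap)
    also have "\<dots> = (\<Sum>i\<in>origins D. \<Sum>j\<in>dests D. \<Sum>a\<in>links D m. \<Sum>r\<in>routes D i j m.
            T i j m r * (g m a * incidence D i j m r a))"
      by (intro sum.cong refl sum.swap)
    also have "\<dots> = (\<Sum>i\<in>origins D. \<Sum>j\<in>dests D. \<Sum>r\<in>routes D i j m. \<Sum>a\<in>links D m.
            T i j m r * (g m a * incidence D i j m r a))"
      by (intro sum.cong refl sum.swap)
    finally show ?thesis
      by (simp add: route_cost_def g_def sum_distrib_left)
  qed
  then have "(\<Sum>m\<in>modes D. \<Sum>a\<in>links D m. g m a * link_flow D q m a)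
      = (\<Sum>m\<in>modes D. \<Sum>i\<in>origins D. \<Sum>j\<in>dests D. \<Sum>r\<in>routes D i j m.
          T i j m r * route_cost D p i j m r)"
    by simp
  also have "\<dots> = (\<Sum>i\<in>origins D. \<Sum>m\<in>modes D. \<Sum>j\<in>dests D. \<Sum>r\<in>routes D i j m.
          T i j m r * route_cost D p i j m r)"
    by (rule sum.swap)
  also have "\<dots> = (\<Sum>i\<in>origins D. \<Sum>j\<in>dests D. \<Sum>m\<in>modes D. \<Sum>r\<in>routes D i j m.
          T i j m r * route_cost D p i j m r)"
    by (intro sum.cong refl sum.swap)
  finally show ?thesis
    unfolding g_def T_def by (subst sum_nests[OF assms])
qed

text \<open>The right-hand side is the part of the Lagrangian without constants and normalization
  terms, with the cost integrals linearized at \<open>p\<close>. Each product of probabilities is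
  factored level by level.\<close>

lemma total_val_eq:
  assumes "valid_data D"
  shows "total_val D w p q =
     - (1 / theta_route D) *
       (\<Sum>i\<in>origins D. \<Sum>j\<in>dests D. \<Sum>M\<in>nests D. \<Sum>m\<in>M. \<Sum>r\<in>routes D i j m.
          demand D i * p_dest q (i, j) * p_nest q (i, j, M) * p_mode q (i, j, M, m) *
          p_route q (i, j, m, r) * ln (p_route q (i, j, m, r) / path_size D i j m r))
     - (\<Sum>m\<in>modes D. \<Sum>a\<in>links D m. link_cost D m a (link_flow D p m a) * link_flow D q m a)
     + mult_entropy_dest w * entropy_dest D q
     + mult_entropy_nest w * entropy_nest D q
     + (\<Sum>M\<in>nests D. mult_entropy_mode w M * entropy_mode D q M)
     + (\<Sum>k\<in>attrs_dest D. mult_attr_dest w k * total_attr_dest D q k)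
     + (\<Sum>k\<in>attrs_mode D. mult_attr_mode w k * total_attr_mode D q k)"
proof -
  let ?I = "\<lambda>f. \<Sum>i\<in>origins D. \<Sum>j\<in>dests D. f i j :: real"
  let ?P = "\<lambda>i j. demand D i * p_dest q (i, j)"
  let ?Q = "\<lambda>i j M. ?P i j * p_nest q (i, j, M)"
  let ?R = "\<lambda>i j M m. ?Q i j M * p_mode q (i, j, M, m)"
  \<comment> \<open>The facts \<open>1\<close>, \<open>2\<close> and \<open>3\<close> bring the sums
    over origins and destinations to the outside, where the nested form has them.\<close>
  have 1: "(\<Sum>k\<in>attrs_dest D. mult_attr_dest w k * total_attr_dest D q k)
      = ?I (\<lambda>i j. ?P i j * dest_utility D w i j)"
  proof -
    have "(\<Sum>k\<in>attrs_dest D. mult_attr_dest w k * total_attr_dest D q k)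
        = (\<Sum>k\<in>attrs_dest D. ?I (\<lambda>i j. ?P i j * (mult_attr_dest w k * attr_dest D k i j)))"
      by (simp add: total_attr_dest_def sum_distrib_left mult_ac)
    also have "\<dots> = (\<Sum>i\<in>origins D. \<Sum>k\<in>attrs_dest D. \<Sum>j\<in>dests D.
        ?P i j * (mult_attr_dest w k * attr_dest D k i j))"
      by (rule sum.swap)
    also have "\<dots> = ?I (\<lambda>i j. \<Sum>k\<in>attrs_dest D. ?P i j * (mult_attr_dest w k * attr_dest D k i j))"
      by (intro sum.cong refl sum.swap)
    finally show ?thesis
      by (simp add: dest_utility_def sum_distrib_left)
  qed
  have 2: "(\<Sum>k\<in>attrs_mode D. mult_attr_mode w k * total_attr_mode D q k)
      = ?I (\<lambda>i j. \<Sum>M\<in>nests D. \<Sum>m\<in>M. ?R i j M m * mode_utility D w i j m)"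
  proof -
    let ?f = "\<lambda>k i j M m. ?R i j M m * (mult_attr_mode w k * attr_mode D k i j m)"
    have "(\<Sum>k\<in>attrs_mode D. mult_attr_mode w k * total_attr_mode D q k)
        = (\<Sum>k\<in>attrs_mode D. ?I (\<lambda>i j. \<Sum>M\<in>nests D. \<Sum>m\<in>M. ?f k i j M m))"
      by (simp add: total_attr_mode_def sum_distrib_left mult_ac)
    also have "\<dots> = (\<Sum>i\<in>origins D. \<Sum>k\<in>attrs_mode D. \<Sum>j\<in>dests D. \<Sum>M\<in>nests D. \<Sum>m\<in>M. ?f k i j M m)"
      by (rule sum.swap)
    also have "\<dots> = ?I (\<lambda>i j. \<Sum>k\<in>attrs_mode D. \<Sum>M\<in>nests D. \<Sum>m\<in>M. ?f k i j M m)"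
      by (intro sum.cong refl sum.swap)
    also have "\<dots> = ?I (\<lambda>i j. \<Sum>M\<in>nests D. \<Sum>k\<in>attrs_mode D. \<Sum>m\<in>M. ?f k i j M m)"
      by (intro sum.cong refl sum.swap)
    also have "\<dots> = ?I (\<lambda>i j. \<Sum>M\<in>nests D. \<Sum>m\<in>M. \<Sum>k\<in>attrs_mode D. ?f k i j M m)"
      by (intro sum.cong refl sum.swap)
    finally show ?thesis
      by (simp add: mode_utility_def sum_distrib_left)
  qed
  have 3: "(\<Sum>M\<in>nests D. mult_entropy_mode w M * entropy_mode D q M)
      = - ?I (\<lambda>i j. \<Sum>M\<in>nests D. \<Sum>m\<in>M. ?R i j M m * (mult_entropy_mode w M * ln (p_mode q (i, j, M, m))))"
  proof -
    let ?f = "\<lambda>i j M m. ?R i j M m * (mult_entropy_mode w M * ln (p_mode q (i, j, M, m)))"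
    have "(\<Sum>M\<in>nests D. mult_entropy_mode w M * entropy_mode D q M)
        = - (\<Sum>M\<in>nests D. ?I (\<lambda>i j. \<Sum>m\<in>M. ?f i j M m))"
      by (simp add: entropy_mode_def sum_distrib_left sum_negf mult_ac)
    also have "(\<Sum>M\<in>nests D. ?I (\<lambda>i j. \<Sum>m\<in>M. ?f i j M m))
        = (\<Sum>i\<in>origins D. \<Sum>M\<in>nests D. \<Sum>j\<in>dests D. \<Sum>m\<in>M. ?f i j M m)"
      by (rule sum.swap)
    also have "\<dots> = ?I (\<lambda>i j. \<Sum>M\<in>nests D. \<Sum>m\<in>M. ?f i j M m)"
      by (intro sum.cong refl sum.swap)
    finally show ?thesis .
  qed
  \<comment> \<open>From here each fact opens one level, innermost first, weighted with the demand
    and the probabilities of the levels above.\<close>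
  have route: "?R i j M m * route_val D p q i j m
      = - (1 / theta_route D) * (\<Sum>r\<in>routes D i j m. ?R i j M m * p_route q (i, j, m, r) *
            ln (p_route q (i, j, m, r) / path_size D i j m r))
        - (\<Sum>r\<in>routes D i j m. ?R i j M m * p_route q (i, j, m, r) * route_cost D p i j m r)" for i j M m
    unfolding route_val_def sum_distrib_left sum_subtractf[symmetric]
    by (intro sum.cong refl) algebra
  have mode: "?Q i j M * mode_val D w p q i j M
      = (\<Sum>m\<in>M. ?R i j M m * mode_utility D w i j m) + (\<Sum>m\<in>M. ?R i j M m * route_val D p q i j m)
        - (\<Sum>m\<in>M. ?R i j M m * (mult_entropy_mode w M * ln (p_mode q (i, j, M, m))))" for i j M
    unfolding mode_val_def sum_distrib_left sum_subtractf[symmetric] sum.distrib[symmetric]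
    by (intro sum.cong refl) algebra
  have nest: "?P i j * nest_val D w p q i j
      = (\<Sum>M\<in>nests D. ?Q i j M * mode_val D w p q i j M)
        - mult_entropy_nest w * (\<Sum>M\<in>nests D. ?Q i j M * ln (p_nest q (i, j, M)))" for i j
    unfolding nest_val_def sum_distrib_left sum_subtractf[symmetric]
    by (intro sum.cong refl) algebra
  have dest: "total_val D w p q
      = ?I (\<lambda>i j. ?P i j * dest_utility D w i j) + ?I (\<lambda>i j. ?P i j * nest_val D w p q i j)
        - mult_entropy_dest w * ?I (\<lambda>i j. ?P i j * ln (p_dest q (i, j)))"
    unfolding total_val_def sum_distrib_left sum_subtractf[symmetric] sum.distrib[symmetric]
    by (intro sum.cong refl) algebra
  show ?thesis
    unfolding link_costs_eq_route_costs[OF assms] 1 2 3 dest nest mode route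
      entropy_dest_def entropy_nest_def
    by (simp add: sum_distrib_left sum_divide_distrib sum.distrib sum_subtractf sum_negf)
qed

text \<open>The linear part of the cost integrals is inside \<open>total_val\<close> and the rest is
  \<open>cost_residual\<close>; \<open>K\<close> is the same for all \<open>q\<close>, so it
  disappears on differentiation.\<close>

lemma lagrangian_eq:
  assumes "valid_data D"
  obtains K where "\<And>q. lagrangian D w q =
    total_val D w p q + normalization_terms D w q - cost_residual D p q + K"
proof
  fix q
  \<comment> \<open>The last bracket is the witness for \<open>K\<close>: the observed values and
    the \<open>- 1\<close> of the normalizations, each times its multiplier.\<close>
  show "lagrangian D w q = total_val D w p q + normalization_terms D w q - cost_residual D p q +
    (- mult_entropy_dest w * obs_entropy_dest D - mult_entropy_nest w * obs_entropy_nest D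
     - (\<Sum>M\<in>nests D. mult_entropy_mode w M * obs_entropy_mode D M)
     - (\<Sum>k\<in>attrs_dest D. mult_attr_dest w k * obs_attr_dest D k)
     - (\<Sum>k\<in>attrs_mode D. mult_attr_mode w k * obs_attr_mode D k)
     - (\<Sum>i\<in>origins D. mult_sum_dest w i)
     - (\<Sum>i\<in>origins D. \<Sum>j\<in>dests D. mult_sum_nest w i j)
     - (\<Sum>i\<in>origins D. \<Sum>j\<in>dests D. \<Sum>M\<in>nests D. mult_sum_mode w i j M)
     - (\<Sum>i\<in>origins D. \<Sum>j\<in>dests D. \<Sum>m\<in>modes D. mult_sum_route w i j m))"
    unfolding lagrangian_def total_val_eq[OF assms, of w p q] normalization_terms_def
      cost_residual_def objective_def
    by (simp add: right_diff_distrib sum_subtractf)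
qed

section \<open>Passing derivatives up the levels\<close>

text \<open>A variable below the destination level acts on the total only through the value of one
  pair \<open>(i, j)\<close>, so its effect is scaled by the trips to that destination.\<close>

lemma total_val_DERIV:
  assumes D: "valid_data D" and "i \<in> origins D" "j \<in> dests D"
    and d: "((\<lambda>y. nest_val D w p (c y) i j) has_real_derivative d) (at x)"
    and dest: "\<And>y. p_dest (c y) = p_dest q"
    and other: "\<And>i' j' y. (i', j') \<noteq> (i, j) \<Longrightarrow> nest_val D w p (c y) i' j' = nest_val D w p q i' j'"
  shows "((\<lambda>y. total_val D w p (c y)) has_real_derivative demand D i * (p_dest q (i, j) * d)) (at x)"
  unfolding total_val_def dest
proof (rule DERIV_sum_single[OF valid_dataD(1)[OF D] assms(2)], rule DERIV_sum_single[OF valid_dataD(2)[OF D] assms(3)])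
  show "((\<lambda>y. demand D i * (p_dest q (i, j) * (dest_utility D w i j + nest_val D w p (c y) i j -
      mult_entropy_dest w * ln (p_dest q (i, j))))) has_real_derivative
      demand D i * (p_dest q (i, j) * d)) (at x)"
    by (auto intro!: derivative_eq_intros d)
qed (simp_all add: other)

text \<open>The hypothesis \<open>other\<close> speaks of nests only: a route probability of mode
  \<open>m\<close> influences every set of modes containing \<open>m\<close>, and only among nests
  is there just one.\<close>

lemma nest_val_DERIV:
  assumes D: "valid_data D" and "M \<in> nests D"
    and d: "((\<lambda>y. mode_val D w p (c y) i j M) has_real_derivative d) (at x)"
    and nest: "\<And>y. p_nest (c y) = p_nest q"
    and other: "\<And>M' y. M' \<in> nests D \<Longrightarrow> M' \<noteq> M \<Longrightarrow> mode_val D w p (c y) i j M' = mode_val D w p q i j M'"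
  shows "((\<lambda>y. nest_val D w p (c y) i j) has_real_derivative p_nest q (i, j, M) * d) (at x)"
  unfolding nest_val_def nest
proof (rule DERIV_sum_single[OF finite_nests[OF D] assms(2)])
  show "((\<lambda>y. p_nest q (i, j, M) * (mode_val D w p (c y) i j M -
      mult_entropy_nest w * ln (p_nest q (i, j, M)))) has_real_derivative p_nest q (i, j, M) * d) (at x)"
    by (auto intro!: derivative_eq_intros d)
qed (simp_all add: other)

lemma mode_val_DERIV:
  assumes D: "valid_data D" and "M \<in> nests D" "m \<in> M"
    and d: "((\<lambda>y. route_val D p (c y) i j m) has_real_derivative d) (at x)"
    and mode: "\<And>y. p_mode (c y) = p_mode q"
    and other: "\<And>m' y. m' \<noteq> m \<Longrightarrow> route_val D p (c y) i j m' = route_val D p q i j m'"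
  shows "((\<lambda>y. mode_val D w p (c y) i j M) has_real_derivative p_mode q (i, j, M, m) * d) (at x)"
  unfolding mode_val_def mode
proof (rule DERIV_sum_single[OF finite_nest[OF D assms(2)] assms(3)])
  show "((\<lambda>y. p_mode q (i, j, M, m) * (mode_utility D w i j m + route_val D p (c y) i j m -
      mult_entropy_mode w M * ln (p_mode q (i, j, M, m)))) has_real_derivative
      p_mode q (i, j, M, m) * d) (at x)"
    by (auto intro!: derivative_eq_intros d)
qed (simp_all add: other)

lemma fun_upd_field_differentiable:
  "(\<lambda>y. (f(a := y)) b) field_differentiable at x"
  by (cases "b = a") simp_all

text \<open>Both orders are stated so that \<open>intro\<close> can strip the constant normalization
  groups on either side of the one that varies.\<close>

lemma DERIV_add_const:
  fixes f :: "real \<Rightarrow> real"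
  assumes "(f has_real_derivative d) F"
  shows "((\<lambda>y. f y + k) has_real_derivative d) F" "((\<lambda>y. k + f y) has_real_derivative d) F"
  using assms by (auto intro!: derivative_eq_intros)

section \<open>First-order conditions at the four levels\<close>

locale stationary_point =
  fixes D :: "('i, 'j, 'm, 'a, 'r, 'k, 'q) travel_data"
    and p :: "('i, 'j, 'm, 'r) choice_probs"
    and w :: "('i, 'j, 'm, 'k, 'q) multipliers"
  assumes valid: "valid_data D" and feas: "feasible D p" and dual: "optimal_dual D p w"
begin

lemma positive: "positive_probs D p"
  using feas by (simp add: feasible_def)

lemma probs_pos:
  assumes "i \<in> origins D" "j \<in> dests D"
  shows "p_dest p (i, j) > 0"
    "M \<in> nests D \<Longrightarrow> p_nest p (i, j, M) > 0"
    "M \<in> nests D \<Longrightarrow> m \<in> M \<Longrightarrow> p_mode p (i, j, M, m) > 0"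
    "m \<in> modes D \<Longrightarrow> r \<in> routes D i j m \<Longrightarrow> p_route p (i, j, m, r) > 0"
  using positive assms unfolding positive_probs_def by blast+

lemma probs_sum:
  assumes "i \<in> origins D"
  shows "(\<Sum>j\<in>dests D. p_dest p (i, j)) = 1"
    "j \<in> dests D \<Longrightarrow> (\<Sum>M\<in>nests D. p_nest p (i, j, M)) = 1"
    "j \<in> dests D \<Longrightarrow> M \<in> nests D \<Longrightarrow> (\<Sum>m\<in>M. p_mode p (i, j, M, m)) = 1"
    "j \<in> dests D \<Longrightarrow> m \<in> modes D \<Longrightarrow> (\<Sum>r\<in>routes D i j m. p_route p (i, j, m, r)) = 1"
  using feas assms unfolding feasible_def by blast+

text \<open>The residual has derivative 0 at \<open>p\<close> and \<open>K\<close> is constant, so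
  by uniqueness of derivatives the two remaining contributions cancel. Below, \<open>c\<close>
  always varies a single probability.\<close>

lemma DERIV_values_zero:
  fixes c :: "real \<Rightarrow> ('i, 'j, 'm, 'r) choice_probs"
  assumes L: "((\<lambda>y. lagrangian D w (c y)) has_real_derivative 0) (at x)" and "c x = p"
    and "\<And>k. (\<lambda>y. p_dest (c y) k) field_differentiable (at x)"
      "\<And>k. (\<lambda>y. p_nest (c y) k) field_differentiable (at x)"
      "\<And>k. (\<lambda>y. p_mode (c y) k) field_differentiable (at x)"
      "\<And>k. (\<lambda>y. p_route (c y) k) field_differentiable (at x)"
    and tot: "((\<lambda>y. total_val D w p (c y)) has_real_derivative d) (at x)"
    and norm: "((\<lambda>y. normalization_terms D w (c y)) has_real_derivative e) (at x)"
  shows "d + e = 0"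
proof -
  obtain K where K: "\<And>q :: ('i, 'j, 'm, 'r) choice_probs. lagrangian D w q =
    total_val D w p q + normalization_terms D w q - cost_residual D p q + K"
    using lagrangian_eq[OF valid] by blast
  have "((\<lambda>y. lagrangian D w (c y)) has_real_derivative d + e - 0 + 0) (at x)"
    unfolding K
    by (intro DERIV_add DERIV_diff tot norm DERIV_const cost_residual_DERIV[where c = c]
        valid positive assms(2-6))
  from DERIV_unique[OF L this] show ?thesis by simp
qed

text \<open>The values of the lower levels do not involve the destination probabilities, so
  \<open>nest_val\<close> acts as a fixed utility.\<close>

lemma dest_stationary:
  assumes "i \<in> origins D" "j \<in> dests D"
  shows "demand D i * (dest_utility D w i j + nest_val D w p p i j
      - mult_entropy_dest w * (ln (p_dest p (i, j)) + 1)) + mult_sum_dest w i = 0"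
proof -
  define c where "c = (\<lambda>y. p\<lparr>p_dest := (p_dest p)((i, j) := y)\<rparr>)"
  note fin = valid_dataD(1,2)[OF valid]
  have nest: "nest_val D w p (c y) i' j' = nest_val D w p p i' j'" for y i' j'
    by (simp add: nest_val_def mode_val_def route_val_def c_def)
  have "((\<lambda>y. total_val D w p (c y)) has_real_derivative demand D i * (dest_utility D w i j
      + nest_val D w p p i j - mult_entropy_dest w * (ln (p_dest p (i, j)) + 1))) (at (p_dest p (i, j)))"
    unfolding total_val_def nest
  proof (rule DERIV_sum_single[OF fin(1) assms(1)], rule DERIV_sum_single[OF fin(2) assms(2)])
    show "((\<lambda>y. demand D i * (p_dest (c y) (i, j) * (dest_utility D w i j + nest_val D w p p i j -
        mult_entropy_dest w * ln (p_dest (c y) (i, j))))) has_real_derivative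
        demand D i * (dest_utility D w i j + nest_val D w p p i j
          - mult_entropy_dest w * (ln (p_dest p (i, j)) + 1))) (at (p_dest p (i, j)))"
      using DERIV_cmult[OF DERIV_entropy_term[OF probs_pos(1)[OF assms], of 1]] by (simp add: c_def)
  qed (auto simp: c_def)
  moreover have "((\<lambda>y. normalization_terms D w (c y)) has_real_derivative mult_sum_dest w i)
      (at (p_dest p (i, j)))"
  proof -
    \<comment> \<open>The varied probability occurs once, with coefficient 1, in the normalization
      sum of \<open>i\<close>; this is why \<open>DERIV_cmult\<close> is used with
      \<open>D = 1\<close>.\<close>
    have "((\<lambda>y. \<Sum>i'\<in>origins D. mult_sum_dest w i' * (\<Sum>j'\<in>dests D. p_dest (c y) (i', j')))
        has_real_derivative mult_sum_dest w i) (at (p_dest p (i, j)))"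
      by (rule DERIV_sum_single[OF fin(1) assms(1)], rule DERIV_cmult[where D = 1, simplified mult_1_right],
          rule DERIV_sum_single[OF fin(2) assms(2)]) (auto simp: c_def)
    moreover have "p_nest (c y) = p_nest p" "p_mode (c y) = p_mode p" "p_route (c y) = p_route p" for y
      by (simp_all add: c_def)
    ultimately show ?thesis
      unfolding normalization_terms_def by (simp only:) (intro DERIV_add_const)
  qed
  ultimately show ?thesis
    using dual assms
    by (intro DERIV_values_zero[of c])
      (auto simp: c_def optimal_dual_def fun_upd_field_differentiable simp del: fun_upd_apply)
qed

text \<open>Mode values are unaffected by nest probabilities; the change in \<open>nest_val\<close>
  reaches the total with the factor \<open>demand D i * p_dest p (i, j)\<close>.\<close>

lemma nest_stationary:
  assumes "i \<in> origins D" "j \<in> dests D" "M \<in> nests D"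
  shows "demand D i * (p_dest p (i, j) * (mode_val D w p p i j M
      - mult_entropy_nest w * (ln (p_nest p (i, j, M)) + 1))) + mult_sum_nest w i j = 0"
proof -
  define c where "c = (\<lambda>y. p\<lparr>p_nest := (p_nest p)((i, j, M) := y)\<rparr>)"
  note fin = valid_dataD(1,2)[OF valid] finite_nests[OF valid]
  have mode: "mode_val D w p (c y) i' j' M' = mode_val D w p p i' j' M'" for y i' j' M'
    by (simp add: mode_val_def route_val_def c_def)
  have "((\<lambda>y. nest_val D w p (c y) i j) has_real_derivative (mode_val D w p p i j M
      - mult_entropy_nest w * (ln (p_nest p (i, j, M)) + 1))) (at (p_nest p (i, j, M)))"
    unfolding nest_val_def mode
  proof (rule DERIV_sum_single[OF fin(3) assms(3)])
    show "((\<lambda>y. p_nest (c y) (i, j, M) * (mode_val D w p p i j M -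
        mult_entropy_nest w * ln (p_nest (c y) (i, j, M)))) has_real_derivative
        mode_val D w p p i j M - mult_entropy_nest w * (ln (p_nest p (i, j, M)) + 1))
        (at (p_nest p (i, j, M)))"
      using DERIV_entropy_term[OF probs_pos(2)[OF assms], of 1] by (simp add: c_def)
  qed (auto simp: c_def)
  then have "((\<lambda>y. total_val D w p (c y)) has_real_derivative
      demand D i * (p_dest p (i, j) * (mode_val D w p p i j M
      - mult_entropy_nest w * (ln (p_nest p (i, j, M)) + 1)))) (at (p_nest p (i, j, M)))"
    by (rule total_val_DERIV[OF valid assms(1,2)])
      (simp add: c_def, simp only: nest_val_def mode, auto simp: c_def intro!: sum.cong)
  moreover have "((\<lambda>y. normalization_terms D w (c y)) has_real_derivative mult_sum_nest w i j)
      (at (p_nest p (i, j, M)))"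
  proof -
    have "((\<lambda>y. \<Sum>i'\<in>origins D. \<Sum>j'\<in>dests D. mult_sum_nest w i' j' * (\<Sum>M'\<in>nests D. p_nest (c y) (i', j', M')))
        has_real_derivative mult_sum_nest w i j) (at (p_nest p (i, j, M)))"
      by (rule DERIV_sum_single[OF fin(1) assms(1)], rule DERIV_sum_single[OF fin(2) assms(2)],
          rule DERIV_cmult[where D = 1, simplified mult_1_right], rule DERIV_sum_single[OF fin(3) assms(3)]) (auto simp: c_def)
    moreover have "p_dest (c y) = p_dest p" "p_mode (c y) = p_mode p" "p_route (c y) = p_route p" for y
      by (simp_all add: c_def)
    ultimately show ?thesis
      unfolding normalization_terms_def by (simp only:) (intro DERIV_add_const)
  qed
  ultimately show ?thesis
    using dual assms
    by (intro DERIV_values_zero[of c])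
      (auto simp: c_def optimal_dual_def fun_upd_field_differentiable simp del: fun_upd_apply)
qed

lemma mode_stationary:
  assumes "i \<in> origins D" "j \<in> dests D" "M \<in> nests D" "m \<in> M"
  shows "demand D i * (p_dest p (i, j) * (p_nest p (i, j, M) *
      (mode_utility D w i j m + route_val D p p i j m
        - mult_entropy_mode w M * (ln (p_mode p (i, j, M, m)) + 1)))) + mult_sum_mode w i j M = 0"
proof -
  define c where "c = (\<lambda>y. p\<lparr>p_mode := (p_mode p)((i, j, M, m) := y)\<rparr>)"
  note fin = valid_dataD(1,2)[OF valid] finite_nests[OF valid] finite_nest[OF valid assms(3)]
  have route: "route_val D p (c y) i' j' m' = route_val D p p i' j' m'" for y i' j' m'
    by (simp add: route_val_def c_def)
  \<comment> \<open>Mode probabilities carry their nest as an index, so no other set of modes sees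
    the change, even if it contains \<open>m\<close>.\<close>
  have mode: "mode_val D w p (c y) i' j' M' = mode_val D w p p i' j' M'"
    if "(i', j', M') \<noteq> (i, j, M)" for y i' j' M'
    unfolding mode_val_def route using that by (intro sum.cong) (auto simp: c_def)
  have "((\<lambda>y. mode_val D w p (c y) i j M) has_real_derivative (mode_utility D w i j m
      + route_val D p p i j m - mult_entropy_mode w M * (ln (p_mode p (i, j, M, m)) + 1)))
      (at (p_mode p (i, j, M, m)))"
    unfolding mode_val_def route
  proof (rule DERIV_sum_single[OF fin(4) assms(4)])
    show "((\<lambda>y. p_mode (c y) (i, j, M, m) * (mode_utility D w i j m + route_val D p p i j m -
        mult_entropy_mode w M * ln (p_mode (c y) (i, j, M, m)))) has_real_derivative
        mode_utility D w i j m + route_val D p p i j m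
          - mult_entropy_mode w M * (ln (p_mode p (i, j, M, m)) + 1)) (at (p_mode p (i, j, M, m)))"
      using DERIV_entropy_term[OF probs_pos(3)[OF assms], of 1] by (simp add: c_def)
  qed (auto simp: c_def)
  then have "((\<lambda>y. nest_val D w p (c y) i j) has_real_derivative p_nest p (i, j, M) *
      (mode_utility D w i j m + route_val D p p i j m
        - mult_entropy_mode w M * (ln (p_mode p (i, j, M, m)) + 1))) (at (p_mode p (i, j, M, m)))"
    by (rule nest_val_DERIV[OF valid assms(3)]) (simp_all add: mode, simp add: c_def)
  then have "((\<lambda>y. total_val D w p (c y)) has_real_derivative
      demand D i * (p_dest p (i, j) * (p_nest p (i, j, M) *
      (mode_utility D w i j m + route_val D p p i j m
        - mult_entropy_mode w M * (ln (p_mode p (i, j, M, m)) + 1))))) (at (p_mode p (i, j, M, m)))"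
  proof (rule total_val_DERIV[OF valid assms(1,2)])
    fix i' j' y
    assume "(i', j') \<noteq> (i, j)"
    then have "mode_val D w p (c y) i' j' M' = mode_val D w p p i' j' M'" for M'
      by (intro mode) auto
    \<comment> \<open>Two passes: the first rewrites the mode values while \<open>c\<close> is
      folded, the second unfolds \<open>c\<close> in the nest probabilities.\<close>
    then show "nest_val D w p (c y) i' j' = nest_val D w p p i' j'"
      by (simp add: nest_val_def) (simp add: c_def)
  qed (simp add: c_def)
  moreover have "((\<lambda>y. normalization_terms D w (c y)) has_real_derivative mult_sum_mode w i j M)
      (at (p_mode p (i, j, M, m)))"
  proof -
    have "((\<lambda>y. \<Sum>i'\<in>origins D. \<Sum>j'\<in>dests D. \<Sum>M'\<in>nests D.
          mult_sum_mode w i' j' M' * (\<Sum>m'\<in>M'. p_mode (c y) (i', j', M', m')))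
        has_real_derivative mult_sum_mode w i j M) (at (p_mode p (i, j, M, m)))"
      by (rule DERIV_sum_single[OF fin(1) assms(1)], rule DERIV_sum_single[OF fin(2) assms(2)],
          rule DERIV_sum_single[OF fin(3) assms(3)], rule DERIV_cmult[where D = 1, simplified mult_1_right],
          rule DERIV_sum_single[OF fin(4) assms(4)]) (auto simp: c_def)
    moreover have "p_dest (c y) = p_dest p" "p_nest (c y) = p_nest p" "p_route (c y) = p_route p" for y
      by (simp_all add: c_def)
    ultimately show ?thesis
      unfolding normalization_terms_def by (simp only:) (intro DERIV_add_const)
  qed
  ultimately show ?thesis
    using dual assms
    by (intro DERIV_values_zero[of c])
      (auto simp: c_def optimal_dual_def fun_upd_field_differentiable simp del: fun_upd_apply)
qed

text \<open>The derivative of the route value is carried through three levels, picking up the mode,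
  nest and destination probabilities and the demand. Route probabilities have no nest index, so
  disjointness of the nests is what confines the change to \<open>M\<close>.\<close>

lemma route_stationary:
  assumes "i \<in> origins D" "j \<in> dests D" "M \<in> nests D" "m \<in> M" "r \<in> routes D i j m"
  shows "demand D i * (p_dest p (i, j) * (p_nest p (i, j, M) * (p_mode p (i, j, M, m) *
      (- route_cost D p i j m r
        - 1 / theta_route D * (ln (p_route p (i, j, m, r) / path_size D i j m r) + 1)))))
      + mult_sum_route w i j m = 0"
proof -
  define c where "c = (\<lambda>y. p\<lparr>p_route := (p_route p)((i, j, m, r) := y)\<rparr>)"
  have m: "m \<in> modes D"
    using nest_subset_modes[OF valid assms(3)] assms(4) by blast
  note fin = valid_dataD(1,2)[OF valid] finite_nest[OF valid assms(3)]
    valid_data_routesD(1)[OF valid assms(1,2) m] valid_dataD(3)[OF valid]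
  have route: "route_val D p (c y) i' j' m' = route_val D p p i' j' m'"
    if "(i', j', m') \<noteq> (i, j, m)" for y i' j' m'
    unfolding route_val_def using that by (intro sum.cong) (auto simp: c_def)
  have "((\<lambda>y. route_val D p (c y) i j m) has_real_derivative (- route_cost D p i j m r
        - 1 / theta_route D * (ln (p_route p (i, j, m, r) / path_size D i j m r) + 1)))
      (at (p_route p (i, j, m, r)))"
    unfolding route_val_def
  proof (rule DERIV_sum_single[OF fin(4) assms(5)])
    show "((\<lambda>y. p_route (c y) (i, j, m, r) * (- route_cost D p i j m r -
        1 / theta_route D * ln (p_route (c y) (i, j, m, r) / path_size D i j m r))) has_real_derivative
        - route_cost D p i j m r
        - 1 / theta_route D * (ln (p_route p (i, j, m, r) / path_size D i j m r) + 1))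
        (at (p_route p (i, j, m, r)))"
      using DERIV_entropy_term[OF probs_pos(4)[OF assms(1,2) m assms(5)]
          path_size_pos[OF valid assms(1,2) m assms(5)],
          of "- route_cost D p i j m r" "1 / theta_route D"] by (simp add: c_def)
  qed (auto simp: c_def)
  then have "((\<lambda>y. mode_val D w p (c y) i j M) has_real_derivative p_mode p (i, j, M, m) *
      (- route_cost D p i j m r
        - 1 / theta_route D * (ln (p_route p (i, j, m, r) / path_size D i j m r) + 1)))
      (at (p_route p (i, j, m, r)))"
    by (rule mode_val_DERIV[OF valid assms(3,4)]) (simp_all add: route, simp add: c_def)
  then have "((\<lambda>y. nest_val D w p (c y) i j) has_real_derivative p_nest p (i, j, M) *
      (p_mode p (i, j, M, m) * (- route_cost D p i j m r
        - 1 / theta_route D * (ln (p_route p (i, j, m, r) / path_size D i j m r) + 1))))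
      (at (p_route p (i, j, m, r)))"
  proof (rule nest_val_DERIV[OF valid assms(3)])
    fix M' y
    assume M': "M' \<in> nests D" "M' \<noteq> M"
    then have "m \<notin> M'"
      using nest_of_eq[OF valid] assms(3,4) by blast
    then have "route_val D p (c y) i j m' = route_val D p p i j m'" if "m' \<in> M'" for m'
      using that by (intro route) auto
    then show "mode_val D w p (c y) i j M' = mode_val D w p p i j M'"
      by (simp add: mode_val_def) (simp add: c_def)
  qed (simp add: c_def)
  then have "((\<lambda>y. total_val D w p (c y)) has_real_derivative
      demand D i * (p_dest p (i, j) * (p_nest p (i, j, M) * (p_mode p (i, j, M, m) *
      (- route_cost D p i j m r
        - 1 / theta_route D * (ln (p_route p (i, j, m, r) / path_size D i j m r) + 1))))))
      (at (p_route p (i, j, m, r)))"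
  proof (rule total_val_DERIV[OF valid assms(1,2)])
    fix i' j' y
    assume "(i', j') \<noteq> (i, j)"
    then have "route_val D p (c y) i' j' m' = route_val D p p i' j' m'" for m'
      by (intro route) auto
    then show "nest_val D w p (c y) i' j' = nest_val D w p p i' j'"
      by (simp add: nest_val_def mode_val_def) (simp add: c_def)
  qed (simp add: c_def)
  moreover have "((\<lambda>y. normalization_terms D w (c y)) has_real_derivative mult_sum_route w i j m)
      (at (p_route p (i, j, m, r)))"
  proof -
    have "((\<lambda>y. \<Sum>i'\<in>origins D. \<Sum>j'\<in>dests D. \<Sum>m'\<in>modes D.
          mult_sum_route w i' j' m' * (\<Sum>r'\<in>routes D i' j' m'. p_route (c y) (i', j', m', r')))
        has_real_derivative mult_sum_route w i j m) (at (p_route p (i, j, m, r)))"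
      by (rule DERIV_sum_single[OF fin(1) assms(1)], rule DERIV_sum_single[OF fin(2) assms(2)],
          rule DERIV_sum_single[OF fin(5) m], rule DERIV_cmult[where D = 1, simplified mult_1_right],
          rule DERIV_sum_single[OF fin(4) assms(5)]) (auto simp: c_def)
    moreover have "p_dest (c y) = p_dest p" "p_nest (c y) = p_nest p" "p_mode (c y) = p_mode p" for y
      by (simp_all add: c_def)
    ultimately show ?thesis
      unfolding normalization_terms_def by (simp only:) (intro DERIV_add_const)
  qed
  ultimately show ?thesis
    using dual assms m
    by (intro DERIV_values_zero[of c])
      (auto simp: c_def optimal_dual_def fun_upd_field_differentiable simp del: fun_upd_apply)
qed

section \<open>Logit probabilities and logsums, from routes to destinations\<close>

text \<open>The level with \<open>b = 1 / theta_route D\<close>, weights \<open>path_size\<close>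
  and utilities minus the route costs; the weight of reaching it is positive and drops out.\<close>

lemma route_logit:
  assumes ij: "i \<in> origins D" "j \<in> dests D" and M: "M \<in> nests D" "m \<in> M"
  defines "Z \<equiv> \<Sum>r\<in>routes D i j m. path_size D i j m r * exp (theta_route D * - route_cost D p i j m r)"
  shows "r \<in> routes D i j m \<Longrightarrow> p_route p (i, j, m, r) =
      path_size D i j m r * exp (theta_route D * - route_cost D p i j m r) / Z"
    and "route_val D p p i j m = 1 / theta_route D * ln Z"
proof -
  have m: "m \<in> modes D"
    using nest_subset_modes[OF valid M(1)] M(2) by blast
  have "demand D i * (p_dest p (i, j) * (p_nest p (i, j, M) * p_mode p (i, j, M, m))) > 0"
    using valid_dataD(6)[OF valid ij(1)] probs_pos[OF ij] M by simp
  moreover have "1 / theta_route D > 0"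
    using valid_dataD(5)[OF valid] by simp
  \<comment> \<open>First with exponents divided by \<open>1 / theta_route D\<close>, as the general
    result yields them; this is rewritten to a product afterwards.\<close>
  ultimately have *: "r \<in> routes D i j m \<Longrightarrow> p_route p (i, j, m, r) = path_size D i j m r *
        exp (- route_cost D p i j m r / (1 / theta_route D)) / (\<Sum>r\<in>routes D i j m.
        path_size D i j m r * exp (- route_cost D p i j m r / (1 / theta_route D)))"
      "route_val D p p i j m = 1 / theta_route D * ln (\<Sum>r\<in>routes D i j m.
        path_size D i j m r * exp (- route_cost D p i j m r / (1 / theta_route D)))" for r
    using entropy_stationary[of "1 / theta_route D"
        "demand D i * (p_dest p (i, j) * (p_nest p (i, j, M) * p_mode p (i, j, M, m)))"
        "routes D i j m" "\<lambda>r. p_route p (i, j, m, r)" "path_size D i j m"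
        "\<lambda>r. - route_cost D p i j m r" "mult_sum_route w i j m"]
      valid_data_routesD(1)[OF valid ij m] probs_pos(4)[OF ij m] path_size_pos[OF valid ij m]
      probs_sum(4)[OF ij m] route_stationary[OF ij M]
    unfolding route_val_def mult.assoc by blast+
  show "r \<in> routes D i j m \<Longrightarrow> p_route p (i, j, m, r) =
      path_size D i j m r * exp (theta_route D * - route_cost D p i j m r) / Z" for r
    using *(1)[of r] by (simp add: Z_def mult.commute)
  show "route_val D p p i j m = 1 / theta_route D * ln Z"
    using *(2) by (simp add: Z_def mult.commute)
qed

text \<open>The level with unit weights and utilities \<open>mode_utility + route_val\<close>, the
  latter being the expected route value.\<close>

lemma mode_logit:
  assumes ij: "i \<in> origins D" "j \<in> dests D" and M: "M \<in> nests D" and b: "mult_entropy_mode w M > 0"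
  defines "Z \<equiv> \<Sum>m\<in>M. exp ((mode_utility D w i j m + route_val D p p i j m) / mult_entropy_mode w M)"
  shows "m \<in> M \<Longrightarrow> p_mode p (i, j, M, m) =
      exp ((mode_utility D w i j m + route_val D p p i j m) / mult_entropy_mode w M) / Z"
    and "mode_val D w p p i j M = mult_entropy_mode w M * ln Z"
proof -
  have "demand D i * (p_dest p (i, j) * p_nest p (i, j, M)) > 0"
    using valid_dataD(6)[OF valid ij(1)] probs_pos[OF ij] M by simp
  \<comment> \<open>Simplification removes the unit weights and nests the products to the right, as
    in the stationarity equation.\<close>
  note level = entropy_stationary[OF b this finite_nest[OF valid M], of "\<lambda>m. p_mode p (i, j, M, m)"
      "\<lambda>_. 1" "\<lambda>m. mode_utility D w i j m + route_val D p p i j m" "mult_sum_mode w i j M",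
      OF probs_pos(3)[OF ij M] _ probs_sum(3)[OF ij M], simplified mult.assoc mult_1 div_by_1, OF _ _ mode_stationary[OF ij M]]
  show "m \<in> M \<Longrightarrow> p_mode p (i, j, M, m) =
      exp ((mode_utility D w i j m + route_val D p p i j m) / mult_entropy_mode w M) / Z" for m
    unfolding Z_def by (rule level(1)) simp_all
  show "mode_val D w p p i j M = mult_entropy_mode w M * ln Z"
    unfolding Z_def mode_val_def by (rule level(2)) simp_all
qed

lemma nest_logit:
  assumes ij: "i \<in> origins D" "j \<in> dests D" and b: "mult_entropy_nest w > 0"
  defines "Z \<equiv> \<Sum>M\<in>nests D. exp (mode_val D w p p i j M / mult_entropy_nest w)"
  shows "M \<in> nests D \<Longrightarrow> p_nest p (i, j, M) = exp (mode_val D w p p i j M / mult_entropy_nest w) / Z"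
    and "nest_val D w p p i j = mult_entropy_nest w * ln Z"
proof -
  have "demand D i * p_dest p (i, j) > 0"
    using valid_dataD(6)[OF valid ij(1)] probs_pos[OF ij] by simp
  note level = entropy_stationary[OF b this finite_nests[OF valid], of "\<lambda>M. p_nest p (i, j, M)"
      "\<lambda>_. 1" "mode_val D w p p i j" "mult_sum_nest w i j",
      OF probs_pos(2)[OF ij] _ probs_sum(2)[OF ij], simplified mult.assoc mult_1 div_by_1, OF _ _ nest_stationary[OF ij]]
  show "M \<in> nests D \<Longrightarrow> p_nest p (i, j, M) = exp (mode_val D w p p i j M / mult_entropy_nest w) / Z" for M
    unfolding Z_def by (rule level(1)) simp_all
  show "nest_val D w p p i j = mult_entropy_nest w * ln Z"
    unfolding Z_def nest_val_def by (rule level(2)) simp_all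
qed

text \<open>At the top level the logsum is not passed on, so only the probabilities are
  extracted.\<close>

lemma dest_logit:
  assumes i: "i \<in> origins D" and j: "j \<in> dests D" and b: "mult_entropy_dest w > 0"
  shows "p_dest p (i, j) = exp ((dest_utility D w i j + nest_val D w p p i j) / mult_entropy_dest w) /
    (\<Sum>j\<in>dests D. exp ((dest_utility D w i j + nest_val D w p p i j) / mult_entropy_dest w))"
  using entropy_stationary(1)[OF b valid_dataD(6)[OF valid i] valid_dataD(2)[OF valid],
      of "\<lambda>j. p_dest p (i, j)" "\<lambda>_. 1" "\<lambda>j. dest_utility D w i j + nest_val D w p p i j"
        "mult_sum_dest w i" j]
    probs_pos(1)[OF i] probs_sum(1)[OF i] dest_stationary[OF i] j
  by simp

end

section \<open>The hierarchical extended logit model\<close>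

theorem theorem3:
  fixes D :: "('i, 'j, 'm, 'a, 'r, 'k, 'q) travel_data"
    and p :: "('i, 'j, 'm, 'r) choice_probs"
    and \<theta>\<^sub>j \<theta>\<^sub>m :: real
    and \<tau> :: "'m set \<Rightarrow> real"
    and \<beta>\<^sub>k :: "'k \<Rightarrow> real" and \<beta>\<^sub>q :: "'q \<Rightarrow> real"
    and lam :: "'i \<Rightarrow> real" and \<mu> :: "'i \<Rightarrow> 'j \<Rightarrow> real"
    and \<kappa> :: "'i \<Rightarrow> 'j \<Rightarrow> 'm set \<Rightarrow> real" and \<nu> :: "'i \<Rightarrow> 'j \<Rightarrow> 'm \<Rightarrow> real"
    and V_dest S_dest :: "'i \<Rightarrow> 'j \<Rightarrow> real"
    and V_mode S_mode :: "'i \<Rightarrow> 'j \<Rightarrow> 'm \<Rightarrow> real"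
    and V_route :: "'i \<Rightarrow> 'j \<Rightarrow> 'm \<Rightarrow> 'r \<Rightarrow> real"
    and IV :: "'i \<Rightarrow> 'j \<Rightarrow> 'm set \<Rightarrow> real"
  assumes data: "valid_data D"
    and primal: "optimal_primal D p"
    and pos: "\<theta>\<^sub>j > 0" "\<theta>\<^sub>m > 0" "\<And>M. M \<in> nests D \<Longrightarrow> \<tau> M > 0"
    and dual: "optimal_dual D p
      \<lparr>mult_entropy_dest = 1 / \<theta>\<^sub>j, mult_entropy_nest = 1 / \<theta>\<^sub>m,
       mult_entropy_mode = (\<lambda>M. \<tau> M / \<theta>\<^sub>m),
       mult_attr_dest = \<beta>\<^sub>k, mult_attr_mode = \<beta>\<^sub>q,
       mult_sum_dest = lam, mult_sum_nest = \<mu>, mult_sum_mode = \<kappa>, mult_sum_route = \<nu>\<rparr>"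
    and V_dest: "\<And>i j. V_dest i j = (\<Sum>k\<in>attrs_dest D. \<beta>\<^sub>k k * attr_dest D k i j)"
    and V_mode: "\<And>i j m. V_mode i j m = (\<Sum>q\<in>attrs_mode D. \<beta>\<^sub>q q * attr_mode D q i j m)"
    and V_route: "\<And>i j m r. V_route i j m r = - route_cost D p i j m r"
    and S_mode: "\<And>i j m. S_mode i j m =
      1 / theta_route D *
      ln (\<Sum>r\<in>routes D i j m. path_size D i j m r * exp (theta_route D * V_route i j m r))"
    and IV: "\<And>i j M. IV i j M =
      \<tau> M * ln (\<Sum>m\<in>M. exp (\<theta>\<^sub>m * (V_mode i j m + S_mode i j m) / \<tau> M))"
    and S_dest: "\<And>i j. S_dest i j = 1 / \<theta>\<^sub>m * ln (\<Sum>M\<in>nests D. exp (IV i j M))"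
  shows "\<forall>i\<in>origins D. \<forall>j\<in>dests D.
    p_dest p (i, j) =
      exp (\<theta>\<^sub>j * (V_dest i j + S_dest i j)) /
      (\<Sum>j'\<in>dests D. exp (\<theta>\<^sub>j * (V_dest i j' + S_dest i j'))) \<and>
    (\<forall>M\<in>nests D.
      p_nest p (i, j, M) = exp (IV i j M) / (\<Sum>M'\<in>nests D. exp (IV i j M')) \<and>
      (\<forall>m\<in>M.
        p_mode p (i, j, M, m) =
          exp (\<theta>\<^sub>m * (V_mode i j m + S_mode i j m) / \<tau> M) /
          (\<Sum>m'\<in>M. exp (\<theta>\<^sub>m * (V_mode i j m' + S_mode i j m') / \<tau> M)) \<and>
        (\<forall>r\<in>routes D i j m.
          p_route p (i, j, m, r) =
            path_size D i j m r * exp (theta_route D * V_route i j m r) /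
            (\<Sum>r'\<in>routes D i j m. path_size D i j m r' * exp (theta_route D * V_route i j m r'))) \<and>
        mode_choice_prob D p i j m = p_nest p (i, j, M) * p_mode p (i, j, M, m)))"
proof -
  define w where "w = \<lparr>mult_entropy_dest = 1 / \<theta>\<^sub>j, mult_entropy_nest = 1 / \<theta>\<^sub>m,
    mult_entropy_mode = (\<lambda>M. \<tau> M / \<theta>\<^sub>m), mult_attr_dest = \<beta>\<^sub>k, mult_attr_mode = \<beta>\<^sub>q,
    mult_sum_dest = lam, mult_sum_nest = \<mu>, mult_sum_mode = \<kappa>, mult_sum_route = \<nu>\<rparr>"
  have w: "mult_entropy_dest w = 1 / \<theta>\<^sub>j" "mult_entropy_nest w = 1 / \<theta>\<^sub>m"
    "mult_entropy_mode w M = \<tau> M / \<theta>\<^sub>m" for M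
    by (simp_all add: w_def)
  have V: "dest_utility D w i j = V_dest i j" "mode_utility D w i j m = V_mode i j m" for i j m
    by (simp_all add: dest_utility_def mode_utility_def V_dest V_mode w_def)
  interpret stationary_point D p w
    using data primal dual
    by unfold_locales (simp_all add: optimal_primal_def is_arg_max_def w_def)
  have S: "route_val D p p i j m = S_mode i j m"
    if "i \<in> origins D" "j \<in> dests D" "M \<in> nests D" "m \<in> M" for i j M m
    unfolding route_logit(2)[OF that] S_mode V_route ..
  \<comment> \<open>The scale of the mode level is the inverse of its entropy multiplier
    \<open>\<tau> M / \<theta>\<^sub>m\<close>.\<close>
  have mode_exp: "exp ((V_mode i j m + S_mode i j m) / (\<tau> M / \<theta>\<^sub>m)) =
      exp (\<theta>\<^sub>m * (V_mode i j m + S_mode i j m) / \<tau> M)" for i j M m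
    by (simp add: mult.commute)
  have mode: "m \<in> M \<Longrightarrow> p_mode p (i, j, M, m) = exp (\<theta>\<^sub>m * (V_mode i j m + S_mode i j m) / \<tau> M) /
        (\<Sum>m'\<in>M. exp (\<theta>\<^sub>m * (V_mode i j m' + S_mode i j m') / \<tau> M))"
    "mode_val D w p p i j M = IV i j M / \<theta>\<^sub>m"
    if "i \<in> origins D" "j \<in> dests D" "M \<in> nests D" for i j M m
  proof -
    have "mult_entropy_mode w M > 0"
      using pos that by (simp add: w)
    note logit = mode_logit[OF that this]
    have "(\<Sum>m\<in>M. exp ((mode_utility D w i j m + route_val D p p i j m) / mult_entropy_mode w M)) =
        (\<Sum>m'\<in>M. exp (\<theta>\<^sub>m * (V_mode i j m' + S_mode i j m') / \<tau> M))"
      using S[OF that] by (intro sum.cong) (simp_all only: V w mode_exp)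
    note logit = logit[unfolded this]
    show "m \<in> M \<Longrightarrow> p_mode p (i, j, M, m) = exp (\<theta>\<^sub>m * (V_mode i j m + S_mode i j m) / \<tau> M) /
        (\<Sum>m'\<in>M. exp (\<theta>\<^sub>m * (V_mode i j m' + S_mode i j m') / \<tau> M))" for m
      using logit(1)[of m] S[OF that, of m] by (simp only: V w mode_exp)
    show "mode_val D w p p i j M = IV i j M / \<theta>\<^sub>m"
      unfolding logit(2) IV w by simp
  qed
  have nest_pos: "mult_entropy_nest w > 0" and dest_pos: "mult_entropy_dest w > 0"
    using pos by (simp_all add: w)
  \<comment> \<open>The mode value is \<open>IV i j M / \<theta>\<^sub>m\<close> and the multiplier
    is \<open>1 / \<theta>\<^sub>m\<close>, so the scale cancels and the nest probabilities involve
    the inclusive value alone.\<close>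
  have nest_exp: "exp (mode_val D w p p i j M / mult_entropy_nest w) = exp (IV i j M)"
    if "i \<in> origins D" "j \<in> dests D" "M \<in> nests D" for i j M
    using mode(2)[OF that] pos by (simp add: w)
  have nest: "M \<in> nests D \<Longrightarrow> p_nest p (i, j, M) = exp (IV i j M) / (\<Sum>M'\<in>nests D. exp (IV i j M'))"
    "nest_val D w p p i j = S_dest i j"
    if "i \<in> origins D" "j \<in> dests D" for i j M
    using nest_logit(1)[OF that nest_pos, of M] nest_logit(2)[OF that nest_pos] nest_exp[OF that]
    by (simp_all add: S_dest w)
  have dest: "p_dest p (i, j) = exp (\<theta>\<^sub>j * (V_dest i j + S_dest i j)) /
      (\<Sum>j'\<in>dests D. exp (\<theta>\<^sub>j * (V_dest i j' + S_dest i j')))"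
    if "i \<in> origins D" "j \<in> dests D" for i j
    using dest_logit[OF that dest_pos] nest(2)[OF that(1)] that(2)
    by (simp add: V w mult.commute)
  have total: "mode_choice_prob D p i j m = p_nest p (i, j, M) * p_mode p (i, j, M, m)"
    if "M \<in> nests D" "m \<in> M" for i j M m
  proof -
    \<comment> \<open>Disjoint nests reduce the law of total probability to one summand.\<close>
    have "{M' \<in> nests D. m \<in> M'} = {M}"
      using that nest_of_eq[OF data] by blast
    then show ?thesis
      by (simp add: mode_choice_prob_def)
  qed
  show ?thesis
    using dest nest(1) mode(1) total route_logit(1) unfolding V_route by blast
qed

end
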